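(* Let $n\ge 1$ and let $A$ and $B$ be $n\times n$ complex positive semidefinite matrices. Then $$\det(I+A\#B)\le\det(I+A^{1/2}B^{1/2}),$$ where $A\#B$ is the geometric mean of $A$ and $B$ and $I$ is the $n\times n$ identity matrix.
   Context: For positive definite $n\times n$ matrices $A,B$ the geometric mean is $A\#B:=A^{1/2}(A^{-1/2}BA^{-1/2})^{1/2}A^{1/2}$. When $A$ and/or $B$ is rank-deficient, it is defined via a limiting procedure: $A\#B:=\lim_{\varepsilon\to0^+}(A+\varepsilon I)\#(B+\varepsilon I)$. Here $X^{1/2}$ denotes the positive semidefinite square root of a positive semidefinite matrix $X$. The matrix $A^{1/2}B^{1/2}$ need not be Hermitian, but as a product of two positive semidefinite matrices it has real non-negative eigenvalues, so $\det(I+A^{1/2}B^{1/2})$ is a real number and the inequality is one between real numbers. *)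

theory Defs
  imports "HOL-Analysis.Analysis"
begin

definition conj_transpose :: "complex^'n^'m \<Rightarrow> complex^'m^'n" where
  "conj_transpose A = (\<chi> i j. cnj (A $ j $ i))"

definition hermitian :: "complex^'n^'n \<Rightarrow> bool" where
  "hermitian A \<longleftrightarrow> conj_transpose A = A"

definition quad_form :: "complex^'n^'n \<Rightarrow> complex^'n \<Rightarrow> complex" where
  "quad_form A x = (\<Sum>i\<in>UNIV. cnj (x $ i) * (A *v x) $ i)"

text \<open>
  For a Hermitian matrix the quadratic form is real-valued, so taking the real part in the
  next two definitions loses nothing.
\<close>

definition pos_semidef :: "complex^'n^'n \<Rightarrow> bool" where
  "pos_semidef A \<longleftrightarrow> hermitian A \<and> (\<forall>x. 0 \<le> Re (quad_form A x))"

definition pos_def :: "complex^'n^'n \<Rightarrow> bool" where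
  "pos_def A \<longleftrightarrow> hermitian A \<and> (\<forall>x. x \<noteq> 0 \<longrightarrow> 0 < Re (quad_form A x))"

text \<open>Only meaningful for positive semidefinite arguments, where the root exists and is unique.\<close>

definition psd_sqrt :: "complex^'n^'n \<Rightarrow> complex^'n^'n" where
  "psd_sqrt A = (THE R. pos_semidef R \<and> R ** R = A)"

definition geom_mean_pd :: "complex^'n^'n \<Rightarrow> complex^'n^'n \<Rightarrow> complex^'n^'n" where
  "geom_mean_pd A B =
     psd_sqrt A ** psd_sqrt (matrix_inv (psd_sqrt A) ** B ** matrix_inv (psd_sqrt A)) ** psd_sqrt A"

text \<open>
  A positive semidefinite matrix is rank-deficient exactly if it is not positive definite.
  The identity matrix is \<open>mat 1\<close>; the numeral \<open>1\<close> would be the matrix with all entries one.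
\<close>

definition geom_mean :: "complex^'n^'n \<Rightarrow> complex^'n^'n \<Rightarrow> complex^'n^'n" (infixl "\<sharp>" 70) where
  "A \<sharp> B =
     (if pos_def A \<and> pos_def B then geom_mean_pd A B
      else Lim (at_right 0)
             (\<lambda>\<epsilon>::real. geom_mean_pd (A + \<epsilon> *\<^sub>R mat 1) (B + \<epsilon> *\<^sub>R mat 1)))"

end

theory Submission
  imports Defs
begin

text \<open>
  For positive definite \<open>A\<close> and \<open>B\<close> put \<open>P = psd_sqrt A\<close>, \<open>Q = psd_sqrt B\<close> and \<open>G = A \<sharp> B\<close>; a polar
  decomposition gives \<open>G = P U Q\<close> with \<open>U\<close> unitary. The inequality
  \<open>\<bar>det (1 + Y X\<^sup>*)\<bar>\<^sup>2 \<le> det (1 + Y Y\<^sup>*) det (1 + X X\<^sup>*)\<close>, applied to \<open>Y = P\<^sup>1\<^sup>/\<^sup>2 U Q\<^sup>1\<^sup>/\<^sup>2\<close> and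
  \<open>X = P\<^sup>1\<^sup>/\<^sup>2 Q\<^sup>1\<^sup>/\<^sup>2\<close>, yields \<open>det (1 + G)\<^sup>2 \<le> \<bar>det (1 + G U\<^sup>*)\<bar> det (1 + P Q)\<close>. Applied to
  \<open>Y = G\<^sup>1\<^sup>/\<^sup>2\<close> and \<open>X = U G\<^sup>1\<^sup>/\<^sup>2\<close> it yields \<open>\<bar>det (1 + G U\<^sup>*)\<bar> \<le> det (1 + G)\<close>, and one factor
  \<open>det (1 + G)\<close> cancels. In the remaining case the limit defining \<open>A \<sharp> B\<close> exists because the
  geometric mean is monotone in both arguments, and the inequality passes to the limit.
\<close>

section \<open>Matrix algebra, the conjugate transpose and the Hermitian inner product\<close>

notation conj_transpose ("_\<^sup>\<dagger>" [1000] 1000)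

lemma matrix_sub_ldistrib: "A ** (B - C) = A ** B - A ** (C :: 'a::ring_1^'n^'k)"
  by (simp add: vec_eq_iff matrix_matrix_mult_def sum_subtractf right_diff_distrib)

lemma matrix_sub_rdistrib: "(B - C) ** A = B ** A - C ** (A :: 'a::ring_1^'n^'k)"
  by (simp add: vec_eq_iff matrix_matrix_mult_def sum_subtractf left_diff_distrib)

lemma matrix_add_rdistrib: "(B + C) ** A = B ** A + C ** (A :: 'a::semiring_1^'n^'k)"
  by (simp add: vec_eq_iff matrix_matrix_mult_def sum.distrib distrib_right)

lemmas matrix_expand = matrix_add_ldistrib matrix_add_rdistrib matrix_sub_ldistrib
  matrix_sub_rdistrib matrix_mul_assoc

lemma conj_transpose_mult: "(A ** B)\<^sup>\<dagger> = B\<^sup>\<dagger> ** A\<^sup>\<dagger>"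
  by (simp add: conj_transpose_def matrix_matrix_mult_def vec_eq_iff mult.commute)

lemma conj_transpose_conj_transpose [simp]: "A\<^sup>\<dagger>\<^sup>\<dagger> = A"
  by (simp add: conj_transpose_def vec_eq_iff)

lemma conj_transpose_mat_1 [simp]: "(mat 1 :: complex^'n^'n)\<^sup>\<dagger> = mat 1"
  by (simp add: conj_transpose_def vec_eq_iff mat_def)

lemma conj_transpose_add: "(A + B)\<^sup>\<dagger> = A\<^sup>\<dagger> + B\<^sup>\<dagger>"
  by (simp add: conj_transpose_def vec_eq_iff)

lemma conj_transpose_diff: "(A - B)\<^sup>\<dagger> = A\<^sup>\<dagger> - B\<^sup>\<dagger>"
  by (simp add: conj_transpose_def vec_eq_iff)

lemma conj_transpose_scaleR: "(c *\<^sub>R A)\<^sup>\<dagger> = c *\<^sub>R A\<^sup>\<dagger>"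
  by (simp add: conj_transpose_def vec_eq_iff)

lemmas conj_transpose_simps = conj_transpose_mult conj_transpose_add conj_transpose_diff
  conj_transpose_scaleR

lemma det_conj_transpose: "det (A\<^sup>\<dagger>) = cnj (det A)"
proof -
  have "det (A\<^sup>\<dagger>) = det (transpose (A\<^sup>\<dagger>))"
    by simp
  also have "transpose (A\<^sup>\<dagger>) = (\<chi> i j. cnj (A $ i $ j))"
    by (simp add: conj_transpose_def transpose_def vec_eq_iff)
  also have "det \<dots> = cnj (det A)"
    by (simp add: det_def)
  finally show ?thesis .
qed

lemma matrix_vector_scaleR:
  fixes A :: "'a::real_algebra_1^'n^'m"
  shows "A *v (c *\<^sub>R x) = c *\<^sub>R (A *v x)"
  by (rule linear_scale) (rule matrix_vector_mul_linear)

text \<open>The Hermitian inner product, conjugate-linear in the first argument. Its real part is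
  \<open>\<bullet>\<close>, which carries all order arguments; \<open>cinner\<close> itself serves
  to express complex orthogonality.\<close>

definition cinner :: "complex^'n \<Rightarrow> complex^'n \<Rightarrow> complex" where
  "cinner x y = (\<Sum>i\<in>UNIV. cnj (x $ i) * y $ i)"

lemma Re_cinner: "Re (cinner x y) = x \<bullet> y"
  by (simp add: cinner_def inner_vec_def inner_complex_def)

lemma cinner_self: "cinner x x = of_real (x \<bullet> x)"
  by (auto simp: complex_eq_iff Re_cinner) (simp add: cinner_def mult.commute)

lemma cinner_commute: "cnj (cinner x y) = cinner y x"
  by (simp add: cinner_def mult.commute)

lemma cinner_iscale: "cinner (\<i> *s x) y = - \<i> * cinner x y"
  by (simp add: cinner_def sum_distrib_left mult.assoc flip: sum_negf)

text \<open>The imaginary part of \<open>cinner x y\<close> is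
  \<open>(\<i> *s x) \<bullet> y\<close>, so complex orthogonality becomes real orthogonality to two
  vectors.\<close>

lemma cinner_zero_iff: "cinner x y = 0 \<longleftrightarrow> x \<bullet> y = 0 \<and> (\<i> *s x) \<bullet> y = 0"
  by (auto simp: complex_eq_iff cinner_iscale simp flip: Re_cinner)

lemma cinner_adjoint: "cinner x (A *v y) = cinner (A\<^sup>\<dagger> *v x) y"
proof -
  have "cinner x (A *v y) = (\<Sum>i\<in>UNIV. \<Sum>j\<in>UNIV. cnj (x $ i) * (A $ i $ j * y $ j))"
    by (simp add: cinner_def matrix_vector_mult_def sum_distrib_left)
  also have "\<dots> = (\<Sum>j\<in>UNIV. \<Sum>i\<in>UNIV. cnj (x $ i) * (A $ i $ j * y $ j))"
    by (rule sum.swap)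
  also have "\<dots> = cinner (A\<^sup>\<dagger> *v x) y"
    by (simp add: cinner_def matrix_vector_mult_def conj_transpose_def sum_distrib_right sum_distrib_left
        mult_ac)
  finally show ?thesis .
qed

lemma inner_adjoint: "x \<bullet> (A *v y) = (A\<^sup>\<dagger> *v x) \<bullet> y" for A :: "complex^'n^'m"
  by (metis Re_cinner cinner_adjoint)

lemma Re_quad_form: "Re (quad_form A x) = x \<bullet> (A *v x)"
  by (simp add: quad_form_def flip: Re_cinner cinner_def)

lemma pos_semidef_iff: "pos_semidef A \<longleftrightarrow> A\<^sup>\<dagger> = A \<and> (\<forall>x. 0 \<le> x \<bullet> (A *v x))"
  by (simp add: pos_semidef_def hermitian_def Re_quad_form)

lemma pos_def_iff: "pos_def A \<longleftrightarrow> A\<^sup>\<dagger> = A \<and> (\<forall>x. x \<noteq> 0 \<longrightarrow> 0 < x \<bullet> (A *v x))"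
  by (simp add: pos_def_def hermitian_def Re_quad_form)

subsection \<open>The spectral theorem\<close>

text \<open>First-order condition at a minimum: if \<open>a\<close> were nonzero,
  \<open>t = - a / c\<close> with \<open>c = \<bar>b\<bar> + 1\<close> would push the expression
  down to at most \<open>- ((a / c)\<^sup>2)\<close>.\<close>

lemma linear_coeff_zero:
  fixes a b :: real
  assumes "\<And>t. 0 \<le> t * a + t\<^sup>2 * b"
  shows "a = 0"
proof (rule ccontr)
  assume "a \<noteq> 0"
  define c where "c = \<bar>b\<bar> + 1"
  have c: "c > 0" "b \<le> c - 1" by (auto simp: c_def)
  have "0 \<le> (- a / c) * a + (- a / c)\<^sup>2 * b" by fact
  also have "\<dots> \<le> (- a / c) * a + (- a / c)\<^sup>2 * (c - 1)"
    using c by (intro add_left_mono mult_left_mono) auto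
  also have "\<dots> = - ((a / c)\<^sup>2)"
    using c(1) by (simp add: power2_eq_square field_simps)
  also have "\<dots> < 0"
    using \<open>a \<noteq> 0\<close> c(1) by simp
  finally show False by simp
qed

text \<open>The real quadratic form of \<open>A\<close> attains a maximum on the compact unit sphere
  of \<open>W\<close>, and a maximizer is an eigenvector. A real subspace \<open>W\<close> is enough
  for this.\<close>

lemma hermitian_eigenvector:
  fixes A :: "complex^'n^'n"
  assumes A: "A\<^sup>\<dagger> = A" and W: "subspace W" "\<And>x. x \<in> W \<Longrightarrow> A *v x \<in> W"
    and ne: "y \<in> W" "y \<noteq> 0"
  shows "\<exists>v\<in>W. norm v = 1 \<and> (\<exists>d. A *v v = d *\<^sub>R v)"
proof -
  have sym: "x \<bullet> (A *v y) = (A *v x) \<bullet> y" for x y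
    by (simp add: inner_adjoint A)
  let ?f = "\<lambda>x. x \<bullet> (A *v x)"
  have cont: "continuous_on S ?f" for S
    by (intro continuous_intros linear_continuous_on) auto
  have "compact (sphere 0 1 \<inter> W)"
    using W(1) by (intro compact_Int_closed closed_subspace) auto
  moreover have "y /\<^sub>R norm y \<in> sphere 0 1 \<inter> W"
    using ne W(1) by (simp add: subspace_scale)
  ultimately obtain v where v: "v \<in> sphere 0 1 \<inter> W" "\<And>x. x \<in> sphere 0 1 \<inter> W \<Longrightarrow> ?f x \<le> ?f v"
    using continuous_attains_sup[OF _ _ cont] by (metis empty_iff)
  define d where "d = ?f v"
  have max: "?f x \<le> d * (x \<bullet> x)" if "x \<in> W" for x
  proof (cases "x = 0")
    case False
    have "?f (x /\<^sub>R norm x) \<le> d"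
      unfolding d_def using False that W(1) by (intro v) (simp add: subspace_scale)
    then show ?thesis
      using False by (simp add: matrix_vector_scaleR field_simps power2_norm_eq_inner[symmetric] power2_eq_square)
  qed simp
  \<comment> \<open>The eigenvalue equation says that the residual \<open>w\<close> vanishes. Moving
    from \<open>v\<close> in the direction \<open>w\<close> stays inside \<open>W\<close>, and
    maximality forces the first-order coefficient \<open>2 * (w \<bullet> w)\<close> to be
    zero.\<close>
  define w where "w = d *\<^sub>R v - A *v v"
  have vW: "v \<in> W" "v \<bullet> v = 1" using v by (auto simp: norm_eq_1)
  have wW: "w \<in> W"
    unfolding w_def using vW W by (simp add: subspace_scale subspace_diff)
  have "0 \<le> t * (2 * (w \<bullet> w)) + t\<^sup>2 * (d * (w \<bullet> w) - ?f w)" for t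
  proof -
    have "v + t *\<^sub>R w \<in> W" using vW wW W by (simp add: subspace_scale subspace_add)
    from max[OF this] have "0 \<le> d * ((v + t *\<^sub>R w) \<bullet> (v + t *\<^sub>R w)) - ?f (v + t *\<^sub>R w)" by simp
    also have "\<dots> = t * (2 * (d * (v \<bullet> w) - w \<bullet> (A *v v))) + t\<^sup>2 * (d * (w \<bullet> w) - ?f w)"
      using vW(2) sym[of v w]
      by (simp add: inner_simps matrix_vector_right_distrib matrix_vector_scaleR
          inner_commute power2_eq_square algebra_simps d_def)
    also have "d * (v \<bullet> w) - w \<bullet> (A *v v) = w \<bullet> w"
      by (simp add: w_def inner_simps inner_commute algebra_simps)
    finally show ?thesis .
  qed
  then have "2 * (w \<bullet> w) = 0" by (rule linear_coeff_zero)
  then have "A *v v = d *\<^sub>R v" by (simp add: w_def)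
  then show ?thesis using v by auto
qed

text \<open>Induction on \<open>k\<close>: the orthogonal complement of the eigenvectors found so
  far is invariant under \<open>A\<close>, because \<open>A\<close> is Hermitian and their
  eigenvalues are real, so it contains a further unit eigenvector.\<close>

lemma orthonormal_eigenvectors:
  fixes A :: "complex^'n^'n"
  assumes A: "A\<^sup>\<dagger> = A" and "k \<le> CARD('n)"
  shows "\<exists>S. finite S \<and> card S = k \<and> (\<forall>x\<in>S. \<forall>y\<in>S. cinner x y = (if x = y then 1 else 0))
           \<and> (\<forall>x\<in>S. \<exists>d. A *v x = d *\<^sub>R x)"
  using assms(2)
proof (induction k)
  case 0
  then show ?case by (intro exI[of _ "{}"]) auto
next
  case (Suc k)
  then obtain S where S: "finite S" "card S = k"
      "\<And>x y. x \<in> S \<Longrightarrow> y \<in> S \<Longrightarrow> cinner x y = (if x = y then 1 else 0)"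
      "\<And>x. x \<in> S \<Longrightarrow> \<exists>d. A *v x = d *\<^sub>R x"
    by (metis Suc_leD)
  define W where "W = {y. \<forall>x\<in>S. cinner x y = 0}"
  have W: "subspace W"
    by (auto simp: W_def subspace_def cinner_zero_iff inner_simps)
  have inv: "A *v y \<in> W" if "y \<in> W" for y
  proof -
    have "cinner x (A *v y) = 0" if "x \<in> S" for x
    proof -
      obtain d where "A *v x = d *\<^sub>R x" using S(4) \<open>x \<in> S\<close> by blast
      then have "cinner x (A *v y) = cinner (d *\<^sub>R x) y" by (simp add: cinner_adjoint A)
      also have "\<dots> = d *\<^sub>R cinner x y"
        by (simp add: cinner_def scaleR_sum_right)
      finally show ?thesis using \<open>y \<in> W\<close> \<open>x \<in> S\<close> by (simp add: W_def)
    qed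
    then show ?thesis by (simp add: W_def)
  qed
  \<comment> \<open>The complex complement \<open>W\<close> is the real complement of
    \<open>S\<close> together with \<open>\<i>\<close> times \<open>S\<close>. These at most
    \<open>2 * k\<close> vectors cannot span the real space of dimension
    \<open>2 * CARD('n)\<close>, so \<open>W\<close> is nontrivial.\<close>
  let ?T = "S \<union> (\<lambda>x. \<i> *s x) ` S"
  have "dim ?T \<le> card ?T" using S(1) by (intro dim_le_card') auto
  also have "\<dots> \<le> 2 * k"
    using card_Un_le[of S "(\<lambda>x. \<i> *s x) ` S"] card_image_le[OF S(1), of "\<lambda>x. \<i> *s x"] S(2) by simp
  also have "\<dots> < DIM(complex^'n)" using Suc.prems by simp
  finally obtain y where y: "y \<noteq> 0" "\<And>x. x \<in> span ?T \<Longrightarrow> orthogonal y x"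
    using orthogonal_to_subspace_exists by blast
  have "x \<bullet> y = 0" if "x \<in> ?T" for x
    using y(2)[OF span_base[OF that]] by (simp add: orthogonal_def inner_commute)
  then have "y \<in> W"
    unfolding W_def cinner_zero_iff by blast
  then obtain v where v: "v \<in> W" "norm v = 1" "\<exists>d. A *v v = d *\<^sub>R v"
    using hermitian_eigenvector[OF A W inv] y(1) by blast
  have vv: "cinner v v = 1" using v(2) by (simp add: cinner_self norm_eq_1)
  have "cinner x v = 0" "cinner v x = 0" if "x \<in> S" for x
    using v(1) that cinner_commute[of x v] by (auto simp: W_def)
  then have "cinner x y = (if x = y then 1 else 0)" if "x \<in> insert v S" "y \<in> insert v S" for x y
    using that S(3) vv by (metis insert_iff zero_neq_one)
  moreover have "v \<notin> S" using v(1) vv by (auto simp: W_def)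
  ultimately show ?case
    using S v(3) by (intro exI[of _ "insert v S"]) auto
qed

definition diag :: "('n \<Rightarrow> real) \<Rightarrow> complex^'n^'n" where
  "diag d = (\<chi> i j. if i = j then of_real (d i) else 0)"

lemma matrix_mult_diag: "(A ** diag d) $ i $ j = A $ i $ j * of_real (d j)"
proof -
  have "(A ** diag d) $ i $ j = (\<Sum>k\<in>UNIV. A $ i $ k * (if k = j then of_real (d k) else 0))"
    by (simp add: matrix_matrix_mult_def diag_def)
  also have "\<dots> = (\<Sum>k\<in>UNIV. if k = j then A $ i $ k * of_real (d k) else 0)"
    by (rule sum.cong) auto
  finally show ?thesis by simp
qed

text \<open>A full orthonormal set of eigenvectors, indexed by \<open>'n\<close> through a
  bijection, supplies the columns of \<open>V\<close>.\<close>

theorem spectral_theorem: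
  fixes A :: "complex^'n^'n"
  assumes A: "A\<^sup>\<dagger> = A"
  obtains V :: "complex^'n^'n" and d where "V\<^sup>\<dagger> ** V = mat 1" "V ** V\<^sup>\<dagger> = mat 1" "A = V ** diag d ** V\<^sup>\<dagger>"
proof -
  obtain S where S: "finite S" "card S = CARD('n)"
      "\<And>x y. x \<in> S \<Longrightarrow> y \<in> S \<Longrightarrow> cinner x y = (if x = y then 1 else 0)"
      "\<And>x. x \<in> S \<Longrightarrow> \<exists>d. A *v x = d *\<^sub>R x"
    using orthonormal_eigenvectors[OF A order_refl] by blast
  obtain f where f: "bij_betw f (UNIV :: 'n set) S"
    using S(1,2) finite_same_card_bij[of "UNIV :: 'n set" S] by auto
  then have fS: "f i \<in> S" and f_eq: "f i = f j \<longleftrightarrow> i = j" for i j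
    by (auto simp: bij_betw_def inj_eq)
  obtain d where d: "\<And>i. A *v f i = d i *\<^sub>R f i" using S(4)[OF fS] by metis
  define V where "V = (\<chi> i j. f j $ i)"
  have 1: "V\<^sup>\<dagger> ** V = mat 1"
  proof -
    have "(V\<^sup>\<dagger> ** V) $ i $ j = cinner (f i) (f j)" for i j
      by (simp add: matrix_matrix_mult_def conj_transpose_def V_def cinner_def)
    then show ?thesis
      unfolding vec_eq_iff using S(3)[OF fS fS] by (simp add: mat_def f_eq)
  qed
  then have 2: "V ** V\<^sup>\<dagger> = mat 1" by (simp add: matrix_left_right_inverse)
  have "(A ** V) $ i $ j = (V ** diag d) $ i $ j" for i j
  proof -
    have "(A ** V) $ i $ j = (A *v f j) $ i"
      by (simp add: matrix_matrix_mult_def matrix_vector_mult_def V_def)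
    also have "\<dots> = (V ** diag d) $ i $ j"
      by (simp add: d matrix_mult_diag V_def) (simp add: scaleR_conv_of_real)
    finally show ?thesis .
  qed
  then have "A ** V = V ** diag d" by (simp add: vec_eq_iff)
  then have "V ** diag d ** V\<^sup>\<dagger> = A ** V ** V\<^sup>\<dagger>" by simp
  also have "\<dots> = A"
    by (simp add: 2 flip: matrix_mul_assoc)
  finally have "A = V ** diag d ** V\<^sup>\<dagger>" by (rule sym)
  with 1 2 show ?thesis by (rule that)
qed

subsection \<open>Positive semidefinite matrices and their square roots\<close>

lemma pos_semidef_conj_transpose: "pos_semidef A \<Longrightarrow> A\<^sup>\<dagger> = A"
  by (simp add: pos_semidef_iff)

lemma pos_semidef_inner: "pos_semidef A \<Longrightarrow> 0 \<le> x \<bullet> (A *v x)"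
  by (simp add: pos_semidef_iff)

lemma pos_semidef_add: "pos_semidef A \<Longrightarrow> pos_semidef B \<Longrightarrow> pos_semidef (A + B)"
  by (simp add: pos_semidef_iff conj_transpose_simps matrix_vector_mult_add_rdistrib inner_simps)

lemma pos_semidef_mat_1: "pos_semidef (mat 1 :: complex^'n^'n)"
  by (simp add: pos_semidef_iff)

lemma pos_semidef_congruence:
  assumes "pos_semidef A"
  shows "pos_semidef (X\<^sup>\<dagger> ** A ** X)"
  unfolding pos_semidef_iff
proof (intro conjI allI)
  show "(X\<^sup>\<dagger> ** A ** X)\<^sup>\<dagger> = X\<^sup>\<dagger> ** A ** X"
    using assms by (simp add: conj_transpose_mult matrix_mul_assoc pos_semidef_conj_transpose)
  fix x
  have "x \<bullet> (X\<^sup>\<dagger> ** A ** X *v x) = x \<bullet> (X\<^sup>\<dagger> *v (A *v (X *v x)))"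
    by (simp add: matrix_vector_mul_assoc matrix_mul_assoc)
  also have "\<dots> = (X *v x) \<bullet> (A *v (X *v x))"
    by (simp add: inner_adjoint[of x "X\<^sup>\<dagger>"])
  finally show "0 \<le> x \<bullet> (X\<^sup>\<dagger> ** A ** X *v x)"
    using pos_semidef_inner[OF assms] by simp
qed

lemma pos_semidef_congruence':
  assumes "pos_semidef A"
  shows "pos_semidef (X ** A ** X\<^sup>\<dagger>)"
  using pos_semidef_congruence[OF assms, of "X\<^sup>\<dagger>"] by simp

lemma pos_semidef_gram: "pos_semidef (X ** X\<^sup>\<dagger>)" for X :: "complex^'n^'n"
  using pos_semidef_congruence'[OF pos_semidef_mat_1, of X] by simp

lemma diag_mult_vec: "(diag d *v x) $ i = d i *\<^sub>R x $ i"
proof -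
  have "(diag d *v x) $ i = (\<Sum>j\<in>UNIV. (if i = j then of_real (d i) else 0) * x $ j)"
    by (simp add: matrix_vector_mult_def diag_def)
  also have "\<dots> = (\<Sum>j\<in>UNIV. if i = j then of_real (d i) * x $ j else 0)"
    by (rule sum.cong) auto
  finally show ?thesis by (simp add: scaleR_conv_of_real)
qed

lemma diag_mult: "diag a ** diag b = diag (\<lambda>i. a i * b i)"
  by (simp add: vec_eq_iff matrix_mult_diag) (simp add: diag_def)

lemma conj_transpose_diag: "(diag d)\<^sup>\<dagger> = diag d"
  by (auto simp: diag_def conj_transpose_def vec_eq_iff)

lemma pos_semidef_diag_iff: "pos_semidef (diag d) \<longleftrightarrow> (\<forall>i. 0 \<le> d i)"
proof
  assume "pos_semidef (diag d)"
  then have "0 \<le> axis i 1 \<bullet> (diag d *v axis i 1)" for i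
    by (rule pos_semidef_inner)
  then show "\<forall>i. 0 \<le> d i"
    by (simp add: inner_axis' diag_mult_vec)
next
  assume "\<forall>i. 0 \<le> d i"
  then show "pos_semidef (diag d)"
    by (auto simp: pos_semidef_iff conj_transpose_diag inner_vec_def diag_mult_vec
        intro!: sum_nonneg)
qed

lemma pos_semidef_unitary_diag:
  fixes V :: "complex^'n^'n"
  assumes "\<And>i. 0 \<le> d i"
  shows "pos_semidef (V ** diag d ** V\<^sup>\<dagger>)"
  by (intro pos_semidef_congruence') (simp add: pos_semidef_diag_iff assms)

lemma unitary_diag_mult:
  assumes "V\<^sup>\<dagger> ** V = mat 1"
  shows "(V ** diag a ** V\<^sup>\<dagger>) ** (V ** diag b ** V\<^sup>\<dagger>) = V ** diag (\<lambda>i. a i * b i) ** V\<^sup>\<dagger>"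
proof -
  have "(V ** diag a ** V\<^sup>\<dagger>) ** (V ** diag b ** V\<^sup>\<dagger>) = V ** diag a ** (V\<^sup>\<dagger> ** V) ** diag b ** V\<^sup>\<dagger>"
    by (simp only: matrix_mul_assoc)
  then show ?thesis by (simp add: assms flip: diag_mult matrix_mul_assoc)
qed

lemma pos_semidef_spectral:
  fixes A :: "complex^'n^'n"
  assumes "pos_semidef A"
  obtains V :: "complex^'n^'n" and d
  where "V\<^sup>\<dagger> ** V = mat 1" "V ** V\<^sup>\<dagger> = mat 1" "A = V ** diag d ** V\<^sup>\<dagger>" "\<And>i. 0 \<le> d i"
proof -
  obtain V :: "complex^'n^'n" and d
    where V: "V\<^sup>\<dagger> ** V = mat 1" "V ** V\<^sup>\<dagger> = mat 1" "A = V ** diag d ** V\<^sup>\<dagger>"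
    using spectral_theorem pos_semidef_conj_transpose[OF assms] by blast
  have "V\<^sup>\<dagger> ** A ** V = (V\<^sup>\<dagger> ** V) ** diag d ** (V\<^sup>\<dagger> ** V)"
    unfolding V(3) by (simp only: matrix_mul_assoc)
  then have "diag d = V\<^sup>\<dagger> ** A ** V" by (simp add: V(1))
  then have "\<forall>i. 0 \<le> d i"
    using pos_semidef_congruence[OF assms] by (simp flip: pos_semidef_diag_iff)
  with V show ?thesis using that by blast
qed

text \<open>In the spectral decomposition some diagonal entry must be negative; the corresponding
  column of \<open>V\<close> is the eigenvector.\<close>

lemma hermitian_not_pos_semidef:
  fixes A :: "complex^'n^'n"
  assumes A: "A\<^sup>\<dagger> = A" and "\<not> pos_semidef A"
  obtains v c where "v \<noteq> 0" "c < 0" "A *v v = c *\<^sub>R v"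
proof -
  obtain V :: "complex^'n^'n" and d
    where V: "V\<^sup>\<dagger> ** V = mat 1" "V ** V\<^sup>\<dagger> = mat 1" "A = V ** diag d ** V\<^sup>\<dagger>"
    using spectral_theorem A by blast
  then obtain i where i: "d i < 0"
    using pos_semidef_unitary_diag assms(2) by (metis not_le)
  define v where "v = V *v axis i 1"
  have *: "V\<^sup>\<dagger> *v v = axis i 1"
    by (simp add: v_def matrix_vector_mul_assoc V)
  have "A *v v = V *v (diag d *v (V\<^sup>\<dagger> *v v))"
    by (simp add: V(3) matrix_vector_mul_assoc matrix_mul_assoc)
  also have "diag d *v (V\<^sup>\<dagger> *v v) = d i *\<^sub>R axis i 1"
    by (auto simp: vec_eq_iff diag_mult_vec * axis_def)
  finally have "A *v v = d i *\<^sub>R v"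
    by (simp add: matrix_vector_scaleR v_def)
  moreover have "v \<noteq> 0"
    using * by (metis axis_eq_0_iff matrix_vector_mult_0_right zero_neq_one)
  ultimately show ?thesis using i that by blast
qed

text \<open>Operator monotonicity of the square root. An eigenvector \<open>v\<close> of
  \<open>Y - X\<close> with eigenvalue \<open>c < 0\<close> would give
  \<open>Y ** Y - X ** X\<close> the quadratic form
  \<open>c * (2 * (v \<bullet> (Y *v v)) - c * (v \<bullet> v))\<close>, which is negative. That
  \<open>X\<close> is merely Hermitian matters in \<open>geom_mean_pd_maximal\<close>.\<close>

lemma square_root_mono:
  fixes X Y :: "complex^'n^'n"
  assumes X: "X\<^sup>\<dagger> = X" and Y: "pos_semidef Y" and XY: "pos_semidef (Y ** Y - X ** X)"
  shows "pos_semidef (Y - X)"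
proof (rule ccontr)
  note Y' = pos_semidef_conj_transpose[OF Y]
  assume "\<not> pos_semidef (Y - X)"
  then obtain v c where v: "v \<noteq> 0" "c < 0" "(Y - X) *v v = c *\<^sub>R v"
    using hermitian_not_pos_semidef[of "Y - X"] X Y' by (auto simp: conj_transpose_simps)
  then have Xv: "Y *v v = X *v v + c *\<^sub>R v"
    by (simp add: matrix_vector_mult_diff_rdistrib algebra_simps)
  have "0 \<le> v \<bullet> ((Y ** Y - X ** X) *v v)"
    by (rule pos_semidef_inner) fact
  also have "\<dots> = (Y *v v) \<bullet> (Y *v v) - (X *v v) \<bullet> (X *v v)"
    by (simp add: matrix_vector_mult_diff_rdistrib inner_simps inner_adjoint X Y'
        flip: matrix_vector_mul_assoc)
  also have "\<dots> = c * (2 * (v \<bullet> (Y *v v)) - c * (v \<bullet> v))"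
    unfolding Xv by (simp add: inner_simps inner_commute algebra_simps)
  finally have "2 * (v \<bullet> (Y *v v)) - c * (v \<bullet> v) \<le> 0"
    using v(2) by (simp add: zero_le_mult_iff)
  moreover have "c * (v \<bullet> v) < 0" using v by (simp add: mult_neg_pos)
  moreover have "0 \<le> v \<bullet> (Y *v v)" by (rule pos_semidef_inner) fact
  ultimately show False by simp
qed

lemma pos_semidef_antisym:
  fixes A :: "complex^'n^'n"
  assumes "pos_semidef A" "pos_semidef (- A)"
  shows "A = 0"
proof -
  obtain V :: "complex^'n^'n" and d
    where V: "V\<^sup>\<dagger> ** V = mat 1" "V ** V\<^sup>\<dagger> = mat 1" "A = V ** diag d ** V\<^sup>\<dagger>" "\<And>i. 0 \<le> d i"
    using pos_semidef_spectral[OF assms(1)] by metis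
  have "V\<^sup>\<dagger> ** A ** V = (V\<^sup>\<dagger> ** V) ** diag d ** (V\<^sup>\<dagger> ** V)"
    unfolding V(3) by (simp only: matrix_mul_assoc)
  then have *: "diag d = V\<^sup>\<dagger> ** A ** V" by (simp add: V(1))
  have "diag (\<lambda>i. - d i) = - diag d"
    by (simp add: diag_def vec_eq_iff)
  also have "\<dots> = V\<^sup>\<dagger> ** (- A) ** V"
    using matrix_sub_ldistrib[of "V\<^sup>\<dagger>" 0 A] matrix_sub_rdistrib[of 0 "V\<^sup>\<dagger> ** A" V]
    by (simp add: *)
  finally have "pos_semidef (diag (\<lambda>i. - d i))"
    using pos_semidef_congruence[OF assms(2)] by simp
  then have "d i = 0" for i
    using V(4)[of i] by (simp add: pos_semidef_diag_iff antisym)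
  then have "diag d = 0" by (simp add: diag_def vec_eq_iff)
  then show ?thesis by (simp add: V(3))
qed

lemma pos_semidef_0: "pos_semidef (0 :: complex^'n^'n)"
  by (simp add: pos_semidef_iff conj_transpose_def vec_eq_iff)

text \<open>Monotonicity in both directions plus antisymmetry of the order. This justifies the
  definite description in \<open>psd_sqrt\<close>.\<close>

lemma square_root_unique:
  fixes R S :: "complex^'n^'n"
  assumes "pos_semidef R" "pos_semidef S" "R ** R = S ** S"
  shows "R = S"
proof -
  have "pos_semidef (R - S)" "pos_semidef (S - R)"
    by (rule square_root_mono; simp add: assms pos_semidef_conj_transpose pos_semidef_0)+
  then show ?thesis using pos_semidef_antisym[of "R - S"] by simp
qed

lemma psd_sqrt_unique: "pos_semidef R \<Longrightarrow> R ** R = A \<Longrightarrow> psd_sqrt A = R"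
  unfolding psd_sqrt_def by (rule the_equality) (use square_root_unique in blast)+

lemma psd_sqrt_unitary_diag:
  fixes V :: "complex^'n^'n"
  assumes "V\<^sup>\<dagger> ** V = mat 1" "\<And>i. 0 \<le> d i"
  shows "psd_sqrt (V ** diag d ** V\<^sup>\<dagger>) = V ** diag (\<lambda>i. sqrt (d i)) ** V\<^sup>\<dagger>"
  using assms by (intro psd_sqrt_unique) (simp_all add: pos_semidef_unitary_diag unitary_diag_mult)

lemma
  fixes A :: "complex^'n^'n"
  assumes "pos_semidef A"
  shows pos_semidef_psd_sqrt: "pos_semidef (psd_sqrt A)"
    and psd_sqrt_square: "psd_sqrt A ** psd_sqrt A = A"
proof -
  obtain V :: "complex^'n^'n" and d
    where V: "V\<^sup>\<dagger> ** V = mat 1" "V ** V\<^sup>\<dagger> = mat 1" "A = V ** diag d ** V\<^sup>\<dagger>" "\<And>i. 0 \<le> d i"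
    using pos_semidef_spectral[OF assms] by metis
  show "pos_semidef (psd_sqrt A)" "psd_sqrt A ** psd_sqrt A = A"
    using V by (simp_all add: psd_sqrt_unitary_diag pos_semidef_unitary_diag unitary_diag_mult)
qed

lemmas conj_transpose_psd_sqrt = pos_semidef_conj_transpose[OF pos_semidef_psd_sqrt]

lemma pos_def_imp_pos_semidef: "pos_def A \<Longrightarrow> pos_semidef A"
  by (auto simp: pos_def_iff pos_semidef_iff) (metis inner_zero_left order_refl less_imp_le)

lemma pos_def_imp_invertible: "pos_def A \<Longrightarrow> invertible A"
  unfolding invertible_left_inverse matrix_left_invertible_ker pos_def_iff
  by (metis inner_zero_right less_irrefl)

lemma invertible_mult_iff:
  fixes A B :: "'a::field^'n^'n"
  shows "invertible (A ** B) \<longleftrightarrow> invertible A \<and> invertible B"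
  by (simp add: invertible_det_nz det_mul)

lemma invertible_psd_sqrt:
  assumes "pos_semidef A" "invertible A"
  shows "invertible (psd_sqrt A)"
  using assms psd_sqrt_square invertible_mult_iff by metis

subsection \<open>Determinantal inequalities\<close>

lemma det_unitary_diag:
  fixes V :: "complex^'n^'n"
  assumes "V ** V\<^sup>\<dagger> = mat 1"
  shows "det (V ** diag d ** V\<^sup>\<dagger>) = of_real (\<Prod>i\<in>UNIV. d i)"
proof -
  have "det V * det (V\<^sup>\<dagger>) = 1"
    using assms by (simp flip: det_mul)
  moreover have "det (diag d) = of_real (\<Prod>i\<in>UNIV. d i)"
    by (subst det_diagonal) (simp_all add: diag_def)
  ultimately show ?thesis by (simp add: det_mul)
qed

text \<open>The determinant is a product of nonnegative eigenvalues. This form packs reality and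
  nonnegativity into one equation, so that estimates can be made with \<open>cmod\<close> and
  transferred to \<open>Re\<close> at the end.\<close>

lemma det_pos_semidef:
  fixes A :: "complex^'n^'n"
  assumes "pos_semidef A"
  shows "det A = of_real (cmod (det A))"
proof -
  obtain V :: "complex^'n^'n" and d
    where V: "V\<^sup>\<dagger> ** V = mat 1" "V ** V\<^sup>\<dagger> = mat 1" "A = V ** diag d ** V\<^sup>\<dagger>" "\<And>i. 0 \<le> d i"
    using pos_semidef_spectral[OF assms] by metis
  then show ?thesis
    by (simp add: det_unitary_diag prod_nonneg del: of_real_prod)
qed

lemma cmod_det_mat_1_plus_ge_1:
  fixes A :: "complex^'n^'n"
  assumes "pos_semidef A"
  shows "1 \<le> cmod (det (mat 1 + A))"
proof -
  obtain V :: "complex^'n^'n" and d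
    where V: "V\<^sup>\<dagger> ** V = mat 1" "V ** V\<^sup>\<dagger> = mat 1" "A = V ** diag d ** V\<^sup>\<dagger>" "\<And>i. 0 \<le> d i"
    using pos_semidef_spectral[OF assms] by metis
  have "diag (\<lambda>i. 1 + d i) = mat 1 + diag d"
    by (auto simp: diag_def mat_def vec_eq_iff)
  then have "mat 1 + A = V ** diag (\<lambda>i. 1 + d i) ** V\<^sup>\<dagger>"
    by (simp add: V matrix_expand)
  then have "det (mat 1 + A) = of_real (\<Prod>i\<in>UNIV. 1 + d i)"
    by (simp only: det_unitary_diag[OF V(2)])
  also have "cmod \<dots> = (\<Prod>i\<in>UNIV. 1 + d i)"
    using V(4) by (simp add: prod_nonneg del: of_real_prod)
  also have "\<dots> \<ge> 1"
    using V(4) by (intro prod_ge_1) simp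
  finally show ?thesis .
qed

lemma
  fixes A :: "'a::semiring_1^'n^'n"
  assumes "invertible A"
  shows matrix_inv_right: "A ** matrix_inv A = mat 1"
    and matrix_inv_left: "matrix_inv A ** A = mat 1"
  using someI_ex[OF assms[unfolded invertible_def]] by (auto simp: matrix_inv_def)

lemma conj_transpose_matrix_inv:
  fixes A :: "complex^'n^'n"
  assumes "A\<^sup>\<dagger> = A" "invertible A"
  shows "(matrix_inv A)\<^sup>\<dagger> = matrix_inv A"
proof -
  have "(matrix_inv A)\<^sup>\<dagger> ** A = mat 1"
    using arg_cong[OF matrix_inv_right[OF assms(2)], of conj_transpose]
    by (simp add: conj_transpose_mult assms(1))
  then show ?thesis
    by (metis assms(2) matrix_inv_right matrix_mul_assoc matrix_mul_lid matrix_mul_rid)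
qed

text \<open>For invertible \<open>M\<close> with root \<open>S\<close>, the factorization
  \<open>M + N = S ** (mat 1 + K) ** S\<close> with \<open>K\<close> positive semidefinite reduces
  the claim to \<open>cmod_det_mat_1_plus_ge_1\<close>; for singular \<open>M\<close> the left side
  is zero.\<close>

lemma cmod_det_mono:
  fixes M N :: "complex^'n^'n"
  assumes M: "pos_semidef M" and N: "pos_semidef N"
  shows "cmod (det M) \<le> cmod (det (M + N))"
proof (cases "invertible M")
  case True
  define S where "S = psd_sqrt M"
  have S: "S\<^sup>\<dagger> = S" "S ** S = M" "invertible S"
    using M True by (simp_all add: S_def conj_transpose_psd_sqrt psd_sqrt_square invertible_psd_sqrt)
  define K where "K = matrix_inv S ** N ** (matrix_inv S)\<^sup>\<dagger>"
  have K: "pos_semidef K"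
    unfolding K_def using N by (rule pos_semidef_congruence')
  have "S ** K ** S = (S ** matrix_inv S) ** N ** (matrix_inv S ** S)"
    by (simp only: K_def conj_transpose_matrix_inv S matrix_mul_assoc)
  also have "\<dots> = N" by (simp add: matrix_inv_right matrix_inv_left S)
  finally have "M + N = S ** (mat 1 + K) ** S"
    by (simp add: matrix_expand S)
  then have "cmod (det (M + N)) = cmod (det M) * cmod (det (mat 1 + K))"
    by (simp add: det_mul norm_mult flip: S(2))
  with mult_left_mono[OF cmod_det_mat_1_plus_ge_1[OF K], of "cmod (det M)"] show ?thesis by simp
qed (simp add: invertible_det_nz)

text \<open>
  This is \<open>cmod_det_mono\<close> applied to a completed square: with \<open>a = mat 1 + X ** X\<^sup>\<dagger>\<close>,
  \<open>b = mat 1 + Y ** X\<^sup>\<dagger>\<close> and \<open>W = b ** matrix_inv a\<close>, the difference of \<open>mat 1 + Y ** Y\<^sup>\<dagger>\<close> and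
  \<open>W ** a ** W\<^sup>\<dagger>\<close> is the sum of the Gram matrices of \<open>mat 1 - W\<close> and \<open>Y - W ** X\<close>.
\<close>

lemma det_Cauchy_Schwarz:
  fixes X Y :: "complex^'n^'n"
  shows "(cmod (det (mat 1 + Y ** X\<^sup>\<dagger>)))\<^sup>2
    \<le> cmod (det (mat 1 + Y ** Y\<^sup>\<dagger>)) * cmod (det (mat 1 + X ** X\<^sup>\<dagger>))"
proof -
  define a where "a = mat 1 + X ** X\<^sup>\<dagger>"
  define b where "b = mat 1 + Y ** X\<^sup>\<dagger>"
  define W where "W = b ** matrix_inv a"
  define K where "K = (mat 1 - W) ** (mat 1 - W)\<^sup>\<dagger> + (Y - W ** X) ** (Y - W ** X)\<^sup>\<dagger>"
  have det_a: "1 \<le> cmod (det a)"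
    unfolding a_def by (intro cmod_det_mat_1_plus_ge_1 pos_semidef_gram)
  then have inv: "invertible a" by (auto simp: invertible_det_nz)
  have a: "pos_semidef a"
    unfolding a_def by (intro pos_semidef_add pos_semidef_mat_1 pos_semidef_gram)
  have K: "pos_semidef K"
    unfolding K_def by (intro pos_semidef_add pos_semidef_gram)
  have Wa: "W ** a = b"
    by (simp add: W_def matrix_inv_left inv flip: matrix_mul_assoc)
  have Wb: "W ** b\<^sup>\<dagger> = b ** W\<^sup>\<dagger>"
    by (simp add: W_def conj_transpose_mult matrix_mul_assoc conj_transpose_matrix_inv
        pos_semidef_conj_transpose a inv)
  have "mat 1 + Y ** Y\<^sup>\<dagger> = K + W ** b\<^sup>\<dagger> + b ** W\<^sup>\<dagger> - W ** a ** W\<^sup>\<dagger>"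
    by (simp add: K_def a_def b_def conj_transpose_simps matrix_expand)
  also have "\<dots> = W ** a ** W\<^sup>\<dagger> + K"
    by (simp add: Wa Wb)
  finally have *: "mat 1 + Y ** Y\<^sup>\<dagger> = W ** a ** W\<^sup>\<dagger> + K" .
  have "cmod (det (W ** a ** W\<^sup>\<dagger>)) \<le> cmod (det (mat 1 + Y ** Y\<^sup>\<dagger>))"
    unfolding * by (intro cmod_det_mono pos_semidef_congruence' a K)
  \<comment> \<open>The extra factor \<open>cmod (det a)\<close> completes the left side to the
    square of \<open>cmod (det b)\<close>, since \<open>b = W ** a\<close>.\<close>
  then have "cmod (det W) * cmod (det W) * cmod (det a) * cmod (det a)
      \<le> cmod (det (mat 1 + Y ** Y\<^sup>\<dagger>)) * cmod (det a)"
    by (intro mult_right_mono) (simp_all add: det_mul norm_mult det_conj_transpose mult_ac)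
  moreover have "cmod (det b) = cmod (det W) * cmod (det a)"
    by (simp add: det_mul norm_mult flip: Wa)
  ultimately show ?thesis
    by (simp add: power2_eq_square mult_ac flip: a_def b_def)
qed

text \<open>Sylvester's determinant identity; with \<open>N\<close> invertible it follows from
  \<open>N ** (mat 1 + M ** N) = (mat 1 + N ** M) ** N\<close>.\<close>

lemma det_mat_1_plus_swap:
  fixes M N :: "'a::field^'n^'n"
  assumes "invertible N"
  shows "det (mat 1 + M ** N) = det (mat 1 + N ** M)"
proof -
  have "N ** (mat 1 + M ** N) = (mat 1 + N ** M) ** N"
    by (simp add: matrix_expand)
  then have "det N * det (mat 1 + M ** N) = det (mat 1 + N ** M) * det N"
    by (metis det_mul)
  then show ?thesis using assms by (simp add: invertible_det_nz)
qed

subsection \<open>The geometric mean of positive definite matrices\<close>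

lemma pos_semidef_sandwich_psd:
  "pos_semidef B \<Longrightarrow> S\<^sup>\<dagger> = S \<Longrightarrow> pos_semidef (S ** B ** S)"
  using pos_semidef_congruence[of B S] by simp

lemma pos_def_psd_sqrt:
  assumes "pos_def A"
  shows "pos_semidef (psd_sqrt A)" "(psd_sqrt A)\<^sup>\<dagger> = psd_sqrt A"
    "psd_sqrt A ** psd_sqrt A = A" "invertible (psd_sqrt A)"
  using assms pos_def_imp_pos_semidef pos_def_imp_invertible
  by (auto intro: pos_semidef_psd_sqrt conj_transpose_psd_sqrt psd_sqrt_square invertible_psd_sqrt)

lemma geom_mean_pd_core:
  fixes A B :: "complex^'n^'n"
  assumes "pos_def A" "pos_semidef B"
  defines "C \<equiv> psd_sqrt (matrix_inv (psd_sqrt A) ** B ** matrix_inv (psd_sqrt A))"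
  shows "pos_semidef C" "C ** C = matrix_inv (psd_sqrt A) ** B ** matrix_inv (psd_sqrt A)"
    "geom_mean_pd A B = psd_sqrt A ** C ** psd_sqrt A"
proof -
  have "pos_semidef (matrix_inv (psd_sqrt A) ** B ** matrix_inv (psd_sqrt A))"
    using assms by (intro pos_semidef_sandwich_psd conj_transpose_matrix_inv pos_def_psd_sqrt)
  then show "pos_semidef C" "C ** C = matrix_inv (psd_sqrt A) ** B ** matrix_inv (psd_sqrt A)"
    by (simp_all add: C_def pos_semidef_psd_sqrt psd_sqrt_square)
  show "geom_mean_pd A B = psd_sqrt A ** C ** psd_sqrt A"
    by (simp add: C_def geom_mean_pd_def)
qed

lemma pos_semidef_geom_mean_pd:
  assumes "pos_def A" "pos_semidef B"
  shows "pos_semidef (geom_mean_pd A B)"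
  using geom_mean_pd_core[OF assms] pos_def_psd_sqrt[OF assms(1)]
  by (simp add: pos_semidef_sandwich_psd)

text \<open>With \<open>C\<close> the inner root of the definition, the Gram matrix of
  \<open>C ** P\<close> is \<open>P ** C ** C ** P = B = Q ** Q\<close>. Hence
  \<open>C ** P = U ** Q\<close> for a unitary \<open>U\<close>, and \<open>P ** C ** P\<close>
  becomes \<open>P ** U ** Q\<close>.\<close>

lemma geom_mean_pd_polar:
  fixes A B :: "complex^'n^'n"
  assumes A: "pos_def A" and B: "pos_def B"
  obtains U where "U\<^sup>\<dagger> ** U = mat 1" "U ** U\<^sup>\<dagger> = mat 1"
    "geom_mean_pd A B = psd_sqrt A ** U ** psd_sqrt B"
proof -
  define P Q P' Q' where PQ: "P = psd_sqrt A" "Q = psd_sqrt B" "P' = matrix_inv P" "Q' = matrix_inv Q"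
  note P = pos_def_psd_sqrt[OF A, folded PQ] and Q = pos_def_psd_sqrt[OF B, folded PQ]
  obtain C where C: "pos_semidef C" "C ** C = P' ** B ** P'" "geom_mean_pd A B = P ** C ** P"
    using geom_mean_pd_core[OF A pos_def_imp_pos_semidef[OF B], folded PQ] by blast
  have inv: "P ** P' = mat 1" "P' ** P = mat 1" "Q ** Q' = mat 1" "Q' ** Q = mat 1" "Q'\<^sup>\<dagger> = Q'"
    using P Q by (simp_all add: PQ(3,4) matrix_inv_right matrix_inv_left conj_transpose_matrix_inv)
  define U where "U = C ** P ** Q'"
  have "U\<^sup>\<dagger> ** U = Q' ** P ** (C ** C) ** P ** Q'"
    by (simp add: U_def conj_transpose_mult P Q inv pos_semidef_conj_transpose[OF C(1)] matrix_mul_assoc)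
  also have "\<dots> = Q' ** (P ** P') ** (Q ** Q) ** (P' ** P) ** Q'"
    by (simp only: C(2) Q matrix_mul_assoc)
  also have "\<dots> = (Q' ** Q) ** (Q ** Q')"
    by (simp only: inv(1,2) matrix_mul_lid matrix_mul_rid matrix_mul_assoc)
  finally have "U\<^sup>\<dagger> ** U = mat 1" by (simp add: inv)
  moreover from this have "U ** U\<^sup>\<dagger> = mat 1" by (simp add: matrix_left_right_inverse)
  moreover have "P ** U ** Q = P ** C ** P ** (Q' ** Q)"
    by (simp only: U_def matrix_mul_assoc)
  then have "geom_mean_pd A B = P ** U ** Q" by (simp add: inv C)
  ultimately show ?thesis using that unfolding PQ by blast
qed

lemma det_geom_mean_pd_le:
  fixes A B :: "complex^'n^'n"
  assumes A: "pos_def A" and B: "pos_def B"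
  shows "det (mat 1 + geom_mean_pd A B) \<in> \<real>"
    and "det (mat 1 + psd_sqrt A ** psd_sqrt B) \<in> \<real>"
    and "Re (det (mat 1 + geom_mean_pd A B)) \<le> Re (det (mat 1 + psd_sqrt A ** psd_sqrt B))"
proof -
  define P Q G where PQ: "P = psd_sqrt A" "Q = psd_sqrt B" and G_def: "G = geom_mean_pd A B"
  note P = pos_def_psd_sqrt[OF A, folded PQ] and Q = pos_def_psd_sqrt[OF B, folded PQ]
  define p q where pq: "p = psd_sqrt P" "q = psd_sqrt Q"
  have p: "p\<^sup>\<dagger> = p" "p ** p = P" "invertible p" and q: "q\<^sup>\<dagger> = q" "q ** q = Q"
    using P Q by (simp_all add: pq conj_transpose_psd_sqrt psd_sqrt_square invertible_psd_sqrt)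
  obtain U where U: "U\<^sup>\<dagger> ** U = mat 1" "U ** U\<^sup>\<dagger> = mat 1" "G = P ** U ** Q"
    using geom_mean_pd_polar[OF A B] unfolding PQ G_def by blast
  have "invertible U" using U invertible_def by blast
  have G: "pos_semidef G"
    unfolding G_def using A pos_def_imp_pos_semidef[OF B] by (rule pos_semidef_geom_mean_pd)
  define g where "g = psd_sqrt G"
  have g: "g\<^sup>\<dagger> = g" "g ** g = G"
    using G by (simp_all add: g_def conj_transpose_psd_sqrt psd_sqrt_square)
  \<comment> \<open>Cycling one outer \<open>p\<close> to the other side merges the two into
    \<open>P\<close>. This identifies the three determinants that occur in
    \<open>det_Cauchy_Schwarz\<close>, as \<open>X\<close>, \<open>Y\<close> and \<open>YX\<close>
    record.\<close>
  have swap: "det (mat 1 + p ** M ** p) = det (mat 1 + P ** M)" for M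
    using det_mat_1_plus_swap[OF p(3), of "p ** M"] by (simp add: p matrix_mul_assoc)

  have X: "det (mat 1 + (p ** q) ** (p ** q)\<^sup>\<dagger>) = det (mat 1 + P ** Q)"
    using swap[of Q] by (simp add: conj_transpose_mult p q matrix_mul_assoc flip: q(2))
  have Y: "det (mat 1 + (p ** U ** q) ** (p ** U ** q)\<^sup>\<dagger>) = det (mat 1 + G ** U\<^sup>\<dagger>)"
    using swap[of "U ** Q ** U\<^sup>\<dagger>"] by (simp add: conj_transpose_mult p q U(3) matrix_mul_assoc flip: q(2))
  have YX: "det (mat 1 + (p ** U ** q) ** (p ** q)\<^sup>\<dagger>) = det (mat 1 + G)"
    using swap[of "U ** Q"] by (simp add: conj_transpose_mult p q U(3) matrix_mul_assoc flip: q(2))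

  \<comment> \<open>The matrix inside is \<open>U ** G ** U\<^sup>\<dagger>\<close>; cycling
    \<open>U\<close> to the right cancels it against its adjoint.\<close>
  have det_UGU: "det (mat 1 + (U ** g) ** (U ** g)\<^sup>\<dagger>) = det (mat 1 + G)"
  proof -
    have "(U ** g) ** (U ** g)\<^sup>\<dagger> = U ** (G ** U\<^sup>\<dagger>)"
      by (simp add: conj_transpose_mult g matrix_mul_assoc flip: g(2))
    moreover have "(G ** U\<^sup>\<dagger>) ** U = G"
      by (simp add: U flip: matrix_mul_assoc)
    ultimately show ?thesis
      using det_mat_1_plus_swap[OF \<open>invertible U\<close>, of "G ** U\<^sup>\<dagger>"] by simp
  qed
  have "(cmod (det (mat 1 + G ** U\<^sup>\<dagger>)))\<^sup>2 \<le> (cmod (det (mat 1 + G)))\<^sup>2"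
    using det_Cauchy_Schwarz[of g "U ** g"] unfolding det_UGU
    by (simp add: conj_transpose_mult g matrix_mul_assoc power2_eq_square)
  then have GU: "cmod (det (mat 1 + G ** U\<^sup>\<dagger>)) \<le> cmod (det (mat 1 + G))"
    by (simp add: power2_le_iff_abs_le)
  have "(cmod (det (mat 1 + G)))\<^sup>2 \<le> cmod (det (mat 1 + G ** U\<^sup>\<dagger>)) * cmod (det (mat 1 + P ** Q))"
    using det_Cauchy_Schwarz[of "p ** U ** q" "p ** q"] unfolding X Y YX .
  also have "\<dots> \<le> cmod (det (mat 1 + G)) * cmod (det (mat 1 + P ** Q))"
    using GU by (intro mult_right_mono) auto
  finally have *: "cmod (det (mat 1 + G)) \<le> cmod (det (mat 1 + P ** Q))"
    using cmod_det_mat_1_plus_ge_1[OF G]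
    unfolding power2_eq_square by (elim mult_left_le_imp_le) linarith
  have 1: "det (mat 1 + G) = of_real (cmod (det (mat 1 + G)))"
    by (intro det_pos_semidef pos_semidef_add pos_semidef_mat_1 G)
  \<comment> \<open>\<open>P ** Q\<close> need not be Hermitian, but by \<open>X\<close> its
    determinant is that of a positive semidefinite matrix.\<close>
  have 2: "det (mat 1 + P ** Q) = of_real (cmod (det (mat 1 + P ** Q)))"
    unfolding X[symmetric] by (intro det_pos_semidef pos_semidef_add pos_semidef_mat_1 pos_semidef_gram)
  show "det (mat 1 + geom_mean_pd A B) \<in> \<real>" "det (mat 1 + psd_sqrt A ** psd_sqrt B) \<in> \<real>"
    unfolding G_def[symmetric] PQ[symmetric] by (subst 1 2, simp)+
  show "Re (det (mat 1 + geom_mean_pd A B)) \<le> Re (det (mat 1 + psd_sqrt A ** psd_sqrt B))"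
    unfolding G_def[symmetric] PQ[symmetric] using * arg_cong[OF 1, of Re] arg_cong[OF 2, of Re] by simp
qed

text \<open>
  The geometric mean is the largest Hermitian \<open>X\<close> for which the block matrix with rows
  \<open>(A, X)\<close> and \<open>(X, B)\<close> is positive semidefinite; the next two lemmas state this with the quadratic
  form of the block matrix written out.
\<close>

lemma geom_mean_pd_block:
  fixes A B :: "complex^'n^'n"
  assumes A: "pos_def A" and B: "pos_def B"
  shows "0 \<le> x \<bullet> (A *v x) + 2 * (x \<bullet> (geom_mean_pd A B *v y)) + y \<bullet> (B *v y)"
proof -
  define P Q G where PQ: "P = psd_sqrt A" "Q = psd_sqrt B" and G_def: "G = geom_mean_pd A B"
  note P = pos_def_psd_sqrt[OF A, folded PQ] and Q = pos_def_psd_sqrt[OF B, folded PQ]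
  obtain U where U: "U\<^sup>\<dagger> ** U = mat 1" "U ** U\<^sup>\<dagger> = mat 1" "G = P ** U ** Q"
    using geom_mean_pd_polar[OF A B] unfolding PQ G_def by blast
  \<comment> \<open>With this \<open>?z\<close> the whole form equals the square
    \<open>(P *v x + ?z) \<bullet> (P *v x + ?z)\<close>; unitarity of \<open>U\<close> turns
    \<open>?z \<bullet> ?z\<close> into the term for \<open>B\<close>.\<close>
  let ?z = "U *v (Q *v y)"
  have "x \<bullet> (A *v x) = (P *v x) \<bullet> (P *v x)"
    using inner_adjoint[of x P "P *v x"] by (simp add: P matrix_vector_mul_assoc)
  moreover have "x \<bullet> (G *v y) = (P *v x) \<bullet> ?z"
    using inner_adjoint[of x P ?z] by (simp add: U P matrix_vector_mul_assoc matrix_mul_assoc)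
  moreover have "y \<bullet> (B *v y) = (Q *v y) \<bullet> (Q *v y)"
    using inner_adjoint[of y Q "Q *v y"] by (simp add: Q matrix_vector_mul_assoc)
  moreover have "?z \<bullet> ?z = (Q *v y) \<bullet> (Q *v y)"
    using inner_adjoint[of ?z U "Q *v y"] by (simp add: matrix_vector_mul_assoc matrix_mul_assoc U)
  moreover have "0 \<le> (P *v x + ?z) \<bullet> (P *v x + ?z)" by simp
  ultimately show ?thesis
    unfolding G_def[symmetric] by (simp add: inner_simps inner_commute)
qed

lemma geom_mean_pd_maximal:
  fixes A B X :: "complex^'n^'n"
  assumes A: "pos_def A" and B: "pos_semidef B" and X: "X\<^sup>\<dagger> = X"
    and block: "\<And>x y. 0 \<le> x \<bullet> (A *v x) + 2 * (x \<bullet> (X *v y)) + y \<bullet> (B *v y)"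
  shows "pos_semidef (geom_mean_pd A B - X)"
proof -
  define P P' where PQ: "P = psd_sqrt A" "P' = matrix_inv P"
  note P = pos_def_psd_sqrt[OF A, folded PQ]
  obtain C where C: "pos_semidef C" "C ** C = P' ** B ** P'" "geom_mean_pd A B = P ** C ** P"
    using geom_mean_pd_core[OF A B, folded PQ] by blast
  have inv: "P ** P' = mat 1" "P' ** P = mat 1" "P'\<^sup>\<dagger> = P'"
    using P by (simp_all add: PQ(2) matrix_inv_right matrix_inv_left conj_transpose_matrix_inv)
  \<comment> \<open>Congruence by \<open>P'\<close> normalizes \<open>A\<close> to the identity and
    turns the claim into \<open>C - T\<close> being positive semidefinite, for which comparing
    squares suffices.\<close>
  define T where "T = P' ** X ** P'"
  have T: "T\<^sup>\<dagger> = T"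
    by (simp add: T_def conj_transpose_mult inv X matrix_mul_assoc)
  have "0 \<le> z \<bullet> ((C ** C - T ** T) *v z)" for z
  proof -
    \<comment> \<open>For fixed \<open>?y\<close> the block form is smallest at minus the inverse of
      \<open>A\<close> applied to \<open>X *v ?y\<close>, which is \<open>- ?w\<close>. This choice
      yields the sharpest inequality.\<close>
    let ?y = "P' *v z" and ?w = "P' *v (T *v z)"
    have "?w \<bullet> (A *v ?w) = (P *v ?w) \<bullet> (P *v ?w)"
      using inner_adjoint[of ?w P "P *v ?w"] by (simp add: P matrix_vector_mul_assoc matrix_mul_assoc)
    also have "P *v ?w = T *v z"
      by (simp add: matrix_vector_mul_assoc matrix_mul_assoc inv)
    finally have 1: "?w \<bullet> (A *v ?w) = (T *v z) \<bullet> (T *v z)" .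
    have "?w \<bullet> (X *v ?y) = (T *v z) \<bullet> (P' *v (X *v ?y))"
      using inner_adjoint[of "T *v z" P' "X *v ?y"] by (simp add: inv)
    also have "P' *v (X *v ?y) = T *v z"
      by (simp add: T_def matrix_vector_mul_assoc matrix_mul_assoc)
    finally have 2: "?w \<bullet> (X *v ?y) = (T *v z) \<bullet> (T *v z)" .
    have 3: "?y \<bullet> (B *v ?y) = z \<bullet> (C ** C *v z)"
      using inner_adjoint[of z P' "B *v ?y"]
      by (simp add: C(2) inv matrix_vector_mul_assoc matrix_mul_assoc)
    have 4: "z \<bullet> (T ** T *v z) = (T *v z) \<bullet> (T *v z)"
      using inner_adjoint[of z T "T *v z"] by (simp add: T matrix_vector_mul_assoc)
    have "A *v (- ?w) = - (A *v ?w)"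
      using matrix_vector_scaleR[of A "-1" ?w] by simp
    then show ?thesis
      using block[of "- ?w" ?y] 1 2 3 4 by (simp add: matrix_vector_mult_diff_rdistrib inner_simps)
  qed
  moreover have "(C ** C - T ** T)\<^sup>\<dagger> = C ** C - T ** T"
    by (simp add: conj_transpose_simps T pos_semidef_conj_transpose[OF C(1)])
  ultimately have "pos_semidef (C ** C - T ** T)"
    by (simp add: pos_semidef_iff)
  with T C(1) have "pos_semidef (C - T)" by (rule square_root_mono)
  then have "pos_semidef (P ** (C - T) ** P)"
    using P by (simp add: pos_semidef_sandwich_psd)
  also have "P ** (C - T) ** P = P ** C ** P - (P ** P') ** X ** (P' ** P)"
    by (simp only: T_def matrix_expand)
  finally show ?thesis by (simp add: C inv)
qed

text \<open>Enlarging the diagonal blocks keeps the block matrix with off-diagonal block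
  \<open>geom_mean_pd A B\<close> positive semidefinite, so maximality for \<open>A'\<close> and
  \<open>B'\<close> applies.\<close>

lemma geom_mean_pd_mono:
  fixes A B :: "complex^'n^'n"
  assumes "pos_def A" "pos_def B" "pos_def A'" "pos_def B'"
    and "pos_semidef (A' - A)" "pos_semidef (B' - B)"
  shows "pos_semidef (geom_mean_pd A' B' - geom_mean_pd A B)"
proof (rule geom_mean_pd_maximal)
  fix x y
  have "x \<bullet> (A *v x) \<le> x \<bullet> (A' *v x)" "y \<bullet> (B *v y) \<le> y \<bullet> (B' *v y)"
    using assms(5,6)[THEN pos_semidef_inner]
    by (simp_all add: matrix_vector_mult_diff_rdistrib inner_simps)
  then show "0 \<le> x \<bullet> (A' *v x) + 2 * (x \<bullet> (geom_mean_pd A B *v y)) + y \<bullet> (B' *v y)"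
    using geom_mean_pd_block[OF assms(1,2), of x y] by simp
qed (use assms in \<open>simp_all add: pos_def_imp_pos_semidef pos_semidef_conj_transpose
    pos_semidef_geom_mean_pd\<close>)

subsection \<open>Passage to the limit\<close>

lemma scaleR_matrix_vector: "(c *\<^sub>R A) *v x = c *\<^sub>R (A *v x)"
  for A :: "'a::real_algebra_1^'n^'m"
  by (simp add: vec_eq_iff matrix_vector_mult_def scaleR_sum_right)

lemma pos_def_add_scaleR_mat_1:
  fixes A :: "complex^'n^'n"
  assumes "pos_semidef A" "0 < \<epsilon>"
  shows "pos_def (A + \<epsilon> *\<^sub>R mat 1)"
proof -
  have "(\<epsilon> *\<^sub>R mat 1) *v x = \<epsilon> *\<^sub>R x" for x :: "complex^'n"
    by (simp add: scaleR_matrix_vector)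
  then show ?thesis
    using assms by (simp add: pos_def_iff pos_semidef_iff conj_transpose_simps
        matrix_vector_mult_add_rdistrib inner_simps add_nonneg_pos)
qed

lemma tendsto_matrix_mult:
  fixes f :: "'b \<Rightarrow> 'a::real_normed_algebra_1^'n^'m" and g :: "'b \<Rightarrow> 'a^'k^'n"
  assumes "(f \<longlongrightarrow> A) F" "(g \<longlongrightarrow> B) F"
  shows "((\<lambda>x. f x ** g x) \<longlongrightarrow> A ** B) F"
  unfolding matrix_matrix_mult_def
  by (intro vec_tendstoI) (auto intro!: tendsto_intros assms)

lemma tendsto_det:
  fixes f :: "'b \<Rightarrow> 'a::real_normed_field^'n^'n"
  assumes "(f \<longlongrightarrow> A) F"
  shows "((\<lambda>x. det (f x)) \<longlongrightarrow> det A) F"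
  unfolding det_def by (intro tendsto_intros assms)

lemma tendsto_diag:
  assumes "\<And>i. ((\<lambda>x. d x i) \<longlongrightarrow> c i) F"
  shows "((\<lambda>x. diag (d x)) \<longlongrightarrow> diag c) F"
  unfolding diag_def
  by (intro vec_tendstoI) (auto intro!: tendsto_of_real assms)

text \<open>Adding a multiple of the identity keeps the diagonalizing \<open>V\<close>, so
  continuity of the real square root in each eigenvalue suffices.\<close>

lemma tendsto_psd_sqrt:
  fixes A :: "complex^'n^'n"
  assumes "pos_semidef A"
  shows "((\<lambda>\<epsilon>. psd_sqrt (A + \<epsilon> *\<^sub>R mat 1)) \<longlongrightarrow> psd_sqrt A) (at_right 0)"
proof -
  obtain V :: "complex^'n^'n" and d
    where V: "V\<^sup>\<dagger> ** V = mat 1" "V ** V\<^sup>\<dagger> = mat 1" "A = V ** diag d ** V\<^sup>\<dagger>" "\<And>i. 0 \<le> d i"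
    using pos_semidef_spectral[OF assms] by metis
  have eq: "psd_sqrt (A + \<epsilon> *\<^sub>R mat 1) = V ** diag (\<lambda>i. sqrt (d i + \<epsilon>)) ** V\<^sup>\<dagger>" if "\<epsilon> > 0" for \<epsilon>
  proof -
    have "diag (\<lambda>i. d i + \<epsilon>) = diag d + \<epsilon> *\<^sub>R mat 1"
      by (auto simp: diag_def mat_def vec_eq_iff) (simp add: scaleR_conv_of_real)
    then have "A + \<epsilon> *\<^sub>R mat 1 = V ** diag (\<lambda>i. d i + \<epsilon>) ** V\<^sup>\<dagger>"
      by (simp add: V matrix_expand matrix_scalar_ac scalar_matrix_assoc[symmetric])
    then show ?thesis
      using V that by (simp add: psd_sqrt_unitary_diag add_nonneg_nonneg)
  qed
  have "((\<lambda>\<epsilon>. V ** diag (\<lambda>i. sqrt (d i + \<epsilon>)) ** V\<^sup>\<dagger>) \<longlongrightarrow> V ** diag (\<lambda>i. sqrt (d i + 0)) ** V\<^sup>\<dagger>)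
      (at_right 0)"
    by (intro tendsto_matrix_mult tendsto_diag tendsto_intros)
  moreover have "V ** diag (\<lambda>i. sqrt (d i + 0)) ** V\<^sup>\<dagger> = psd_sqrt A"
    using V by (simp add: psd_sqrt_unitary_diag)
  ultimately show ?thesis
    by (auto elim!: Lim_transform_eventually simp: eq eventually_at_right_less
        intro!: eventually_at_rightI[of 0 1])
qed

text \<open>Quadratic forms are monotone and bounded below by zero, hence converge; polarization
  carries this over to the bilinear forms, and these include the real and imaginary parts of all
  entries.\<close>

lemma pos_semidef_mono_convergent:
  fixes F :: "real \<Rightarrow> complex^'n^'n"
  assumes psd: "\<And>a. 0 < a \<Longrightarrow> pos_semidef (F a)"
    and mono: "\<And>a b. 0 < a \<Longrightarrow> a \<le> b \<Longrightarrow> pos_semidef (F b - F a)"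
  obtains L where "(F \<longlongrightarrow> L) (at_right 0)"
proof -
  have quad: "\<exists>l. ((\<lambda>a. x \<bullet> (F a *v x)) \<longlongrightarrow> l) (at_right 0)" for x
  proof -
    \<comment> \<open>The intersection with \<open>UNIV\<close> is the shape that
      \<open>Lim_right_bound\<close> produces.\<close>
    have "((\<lambda>a. x \<bullet> (F a *v x)) \<longlongrightarrow> Inf ((\<lambda>a. x \<bullet> (F a *v x)) ` ({0<..} \<inter> UNIV)))
        (at 0 within ({0<..} \<inter> UNIV))"
      by (rule Lim_right_bound[where K = 0])
        (use pos_semidef_inner[OF mono] pos_semidef_inner[OF psd] in
          \<open>auto simp: matrix_vector_mult_diff_rdistrib inner_simps\<close>)
    then show ?thesis by auto
  qed
  have bil: "\<exists>l. ((\<lambda>a. x \<bullet> (F a *v y)) \<longlongrightarrow> l) (at_right 0)" for x y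
  proof -
    obtain l1 l2 l3 where l: "((\<lambda>a. (x + y) \<bullet> (F a *v (x + y))) \<longlongrightarrow> l1) (at_right 0)"
      "((\<lambda>a. x \<bullet> (F a *v x)) \<longlongrightarrow> l2) (at_right 0)" "((\<lambda>a. y \<bullet> (F a *v y)) \<longlongrightarrow> l3) (at_right 0)"
      using quad by metis
    have "((\<lambda>a. ((x + y) \<bullet> (F a *v (x + y)) - x \<bullet> (F a *v x) - y \<bullet> (F a *v y)) / 2)
        \<longlongrightarrow> (l1 - l2 - l3) / 2) (at_right 0)"
      by (intro tendsto_intros l) simp
    moreover have "((x + y) \<bullet> (F a *v (x + y)) - x \<bullet> (F a *v x) - y \<bullet> (F a *v y)) / 2 = x \<bullet> (F a *v y)"
      if "0 < a" for a
      using inner_adjoint[of y "F a" x] pos_semidef_conj_transpose[OF psd[OF that]]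
      by (simp add: matrix_vector_right_distrib inner_simps inner_commute)
    then have "eventually (\<lambda>a. ((x + y) \<bullet> (F a *v (x + y)) - x \<bullet> (F a *v x) - y \<bullet> (F a *v y)) / 2
        = x \<bullet> (F a *v y)) (at_right 0)"
      by (intro eventually_at_rightI[of 0 1]) auto
    ultimately show ?thesis by (blast intro: Lim_transform_eventually)
  qed
  have entry: "(M *v axis j 1) $ i = M $ i $ j" for M :: "complex^'n^'n" and i j
    by (simp add: matrix_vector_mult_def axis_def if_distrib[of "(*) c" for c] cong: if_cong)
  \<comment> \<open>Pairing with \<open>\<i>\<close> under the real inner product of complex numbers
    picks out the imaginary part.\<close>
  have Re: "axis i 1 \<bullet> (M *v axis j 1) = Re (M $ i $ j)"
    and Im: "axis i \<i> \<bullet> (M *v axis j 1) = Im (M $ i $ j)" for M :: "complex^'n^'n" and i j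
    by (simp_all add: inner_axis' entry inner_complex_def)
  obtain R where R: "\<And>i j. ((\<lambda>a. Re (F a $ i $ j)) \<longlongrightarrow> R i j) (at_right 0)"
    using bil[of "axis _ 1" "axis _ 1"] unfolding Re by metis
  obtain J where J: "\<And>i j. ((\<lambda>a. Im (F a $ i $ j)) \<longlongrightarrow> J i j) (at_right 0)"
    using bil[of "axis _ \<i>" "axis _ 1"] unfolding Im by metis
  have "(F \<longlongrightarrow> (\<chi> i j. Complex (R i j) (J i j))) (at_right 0)"
    using R J by (intro vec_tendstoI) (simp add: tendsto_complex_iff)
  then show ?thesis by (rule that)
qed

text \<open>Both determinants are complex-valued terms; asserting that they are real makes the
  comparison of real parts an inequality between the determinants themselves.\<close>

theorem theorem2:
  fixes A B :: "complex^'n^'n"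
  assumes "pos_semidef A" and "pos_semidef B"
  shows "det (mat 1 + A \<sharp> B) \<in> \<real> \<and>
         det (mat 1 + psd_sqrt A ** psd_sqrt B) \<in> \<real> \<and>
         Re (det (mat 1 + A \<sharp> B)) \<le> Re (det (mat 1 + psd_sqrt A ** psd_sqrt B))"
proof (cases "pos_def A \<and> pos_def B")
  case True
  then show ?thesis by (simp add: geom_mean_def det_geom_mean_pd_le)
next
  case False
  define A' B' where "A' = (\<lambda>\<epsilon>. A + \<epsilon> *\<^sub>R mat 1)" and "B' = (\<lambda>\<epsilon>. B + \<epsilon> *\<^sub>R mat 1)"
  define G where "G = (\<lambda>\<epsilon>. geom_mean_pd (A' \<epsilon>) (B' \<epsilon>))"
  have pd: "pos_def (A' \<epsilon>)" "pos_def (B' \<epsilon>)" if "\<epsilon> > 0" for \<epsilon>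
    using assms that by (simp_all add: A'_def B'_def pos_def_add_scaleR_mat_1)
  have "pos_semidef (c *\<^sub>R mat 1 :: complex^'n^'n)" if "c \<ge> 0" for c
  proof (cases "c = 0")
    case False
    then show ?thesis
      using pos_def_add_scaleR_mat_1[OF pos_semidef_0, of c] that pos_def_imp_pos_semidef by simp
  qed (simp add: pos_semidef_0)
  then have "pos_semidef (A' b - A' a)" "pos_semidef (B' b - B' a)" if "a \<le> b" for a b
    using that by (simp_all add: A'_def B'_def flip: scaleR_diff_left)
  then have "pos_semidef (G b - G a)" if "0 < a" "a \<le> b" for a b
    unfolding G_def using that by (intro geom_mean_pd_mono pd) auto
  moreover have "pos_semidef (G a)" if "0 < a" for a
    unfolding G_def using that by (intro pos_semidef_geom_mean_pd pos_def_imp_pos_semidef pd)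
  ultimately obtain L where L: "(G \<longlongrightarrow> L) (at_right 0)"
    using pos_semidef_mono_convergent[of G] by blast
  \<comment> \<open>\<open>Lim\<close> is meaningful only once convergence is known, which
    monotonicity of \<open>G\<close> has just provided.\<close>
  then have "A \<sharp> B = L"
    unfolding geom_mean_def if_not_P[OF False] G_def A'_def B'_def by (intro tendsto_Lim) auto
  with L have lim1: "((\<lambda>\<epsilon>. det (mat 1 + G \<epsilon>)) \<longlongrightarrow> det (mat 1 + A \<sharp> B)) (at_right 0)"
    by (auto intro!: tendsto_det tendsto_intros)
  have lim2: "((\<lambda>\<epsilon>. det (mat 1 + psd_sqrt (A' \<epsilon>) ** psd_sqrt (B' \<epsilon>)))
      \<longlongrightarrow> det (mat 1 + psd_sqrt A ** psd_sqrt B)) (at_right 0)"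
    unfolding A'_def B'_def
    by (intro tendsto_det tendsto_matrix_mult tendsto_psd_sqrt tendsto_add tendsto_const assms)
  have ev: "eventually (\<lambda>\<epsilon>::real. \<epsilon> > 0) (at_right 0)"
    by (simp add: eventually_at_right_less)
  \<comment> \<open>These facts hold for every positive \<open>\<epsilon>\<close>. Reality survives
    the limit because the reals are closed in the complex plane, and the inequality because
    \<open>\<le>\<close> is preserved.\<close>
  note le = det_geom_mean_pd_le[OF pd, folded G_def]
  show ?thesis
  proof (intro conjI)
    show "det (mat 1 + A \<sharp> B) \<in> \<real>"
      by (rule Lim_in_closed_set[OF closed_complex_Reals _ _ lim1])
        (use ev le(1) in \<open>auto simp: G_def elim: eventually_mono\<close>)
    show "det (mat 1 + psd_sqrt A ** psd_sqrt B) \<in> \<real>"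
      by (rule Lim_in_closed_set[OF closed_complex_Reals _ _ lim2])
        (use ev le(2) in \<open>auto elim: eventually_mono\<close>)
    show "Re (det (mat 1 + A \<sharp> B)) \<le> Re (det (mat 1 + psd_sqrt A ** psd_sqrt B))"
      by (rule tendsto_le[OF _ tendsto_Re[OF lim2] tendsto_Re[OF lim1]])
        (use ev le(3) in \<open>auto simp: G_def elim: eventually_mono\<close>)
  qed
qed

end
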